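(* Let $g:S^1\to\mathbb{R}$ be a non-zero analytic function with $\int_{S^1} g(x)\,dx=0$. For $\lambda\in\mathbb{R}$ let $T_\lambda:S^1\times\mathbb{R}\to S^1\times\mathbb{R}$, $T_\lambda(x,y)=(x',y')$, be defined by $$y'=g(x)+y+\lambda,\qquad x'=x+y' \bmod 1.$$ Then $\rho_V^{\max}(T_\lambda)$ is a non-decreasing function of $\lambda$.
   Context: $S^1=\mathbb{R}/\mathbb{Z}$. A function $g:S^1\to\mathbb{R}$ is called analytic if it is induced by a (real-)analytic function $\widetilde g:\mathbb{R}\to\mathbb{R}$ with $\widetilde g(x+1)=\widetilde g(x)$; $\int_{S^1} g(x)\,dx$ means $\int_0^1\widetilde g(x)\,dx$. Let $p_2(x,y)=y$ on $S^1\times\mathbb{R}$. For each $\lambda$, the vertical rotation set $\rho_V(T_\lambda)\subset\mathbb{R}$ is the set of all $\omega\in\mathbb{R}$ for which there is a point $X\in S^1\times\mathbb{R}$ with $$\lim_{n\to\infty}\frac{p_2\circ T_\lambda^n(X)-p_2(X)}{n}=\omega .$$ It is a closed bounded interval $[\rho_V^{\min}(T_\lambda),\rho_V^{\max}(T_\lambda)]$, and $\rho_V^{\max}(T_\lambda)$ denotes its maximum. *)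

theory Defs
  imports "HOL-Analysis.Analysis"
begin

definition cong1 :: "real \<Rightarrow> real \<Rightarrow> bool" where
  "cong1 x y \<longleftrightarrow> x - y \<in> \<int>"

lemma equivp_cong1: "equivp cong1"
proof (rule equivpI)
  show "reflp cong1"
    by (auto simp: reflp_def cong1_def)
  show "symp cong1"
    by (auto simp: symp_def cong1_def) (metis Ints_minus minus_diff_eq)
  show "transp cong1"
    by (auto simp: transp_def cong1_def) (metis Ints_add diff_add_cancel add_diff_eq)
qed

quotient_type circle = real / cong1
  morphisms rep_circle to_circle
  by (rule equivp_cong1)

instantiation circle :: ab_group_add
begin

lift_definition zero_circle :: circle is 0 .

lift_definition plus_circle :: "circle \<Rightarrow> circle \<Rightarrow> circle" is "(+)"
  unfolding cong1_def by (metis Ints_add add_diff_add)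

lift_definition uminus_circle :: "circle \<Rightarrow> circle" is uminus
  unfolding cong1_def by (metis Ints_minus minus_diff_minus)

lift_definition minus_circle :: "circle \<Rightarrow> circle \<Rightarrow> circle" is "(-)"
  unfolding cong1_def by (metis Ints_diff diff_diff_eq2 add_diff_eq diff_diff_eq add.commute diff_add_eq)

instance
  by standard (transfer; simp add: cong1_def)+

end

text \<open>\<open>has_fps_expansion\<close> speaks about expansions at \<open>0\<close>, hence the translation by \<open>x\<close>.
  It includes positivity of the radius of convergence.\<close>

definition real_analytic :: "(real \<Rightarrow> real) \<Rightarrow> bool" where
  "real_analytic f \<longleftrightarrow> (\<forall>x. \<exists>F. (\<lambda>h. f (x + h)) has_fps_expansion F)"

definition circle_analytic :: "(circle \<Rightarrow> real) \<Rightarrow> bool" where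
  "circle_analytic g \<longleftrightarrow>
     (\<exists>f. real_analytic f \<and> (\<forall>x. f (x + 1) = f x) \<and> (\<forall>x. g (to_circle x) = f x))"

text \<open>If \<open>g\<close> is induced by a periodic \<open>f\<close>, then \<open>\<lambda>x. g (to_circle x)\<close> is \<open>f\<close>.\<close>

definition circle_integral :: "(circle \<Rightarrow> real) \<Rightarrow> real" where
  "circle_integral g = integral {0..1} (\<lambda>x. g (to_circle x))"

definition twist_map :: "(circle \<Rightarrow> real) \<Rightarrow> real \<Rightarrow> circle \<times> real \<Rightarrow> circle \<times> real" where
  "twist_map g l = (\<lambda>(x, y). let y' = g x + y + l in (x + to_circle y', y'))"

definition vertical_rotation_set :: "(circle \<times> real \<Rightarrow> circle \<times> real) \<Rightarrow> real set" where
  "vertical_rotation_set T =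
     {\<omega>. \<exists>X. (\<lambda>n. (snd ((T ^^ n) X) - snd X) / real n) \<longlonglongrightarrow> \<omega>}"

text \<open>\<open>GREATEST\<close> is the attained maximum; for twist maps with analytic \<open>g\<close> the set is a closed
  bounded (nonempty) interval, so the maximum exists.\<close>

definition rho_V_max :: "(circle \<times> real \<Rightarrow> circle \<times> real) \<Rightarrow> real" where
  "rho_V_max T = (GREATEST \<omega>. \<omega> \<in> vertical_rotation_set T)"

end

theory Submission imports Defs begin

text \<open>
  Orbits of the lift of \<open>T\<^sub>\<lambda>\<close> correspond to solutions of
  \<open>u\<^bsub>i-1\<^esub> + u\<^bsub>i+1\<^esub> - 2 u\<^sub>i = g(u\<^sub>i) + \<lambda>\<close>, the vertical coordinate being \<open>u\<^bsub>i+1\<^esub> - u\<^sub>i\<close>.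
  For \<open>\<lambda> < \<lambda>'\<close>, an orbit segment \<open>u\<close> of \<open>T\<^sub>\<lambda>\<close> is a strict supersolution for \<open>\<lambda>'\<close>. Perron's method
  yields an orbit segment \<open>z \<le> u\<close> of \<open>T\<^bsub>\<lambda>'\<^esub>\<close> with the same end points; then the first increment of
  \<open>z\<close> is at most that of \<open>u\<close> and the last one at least that of \<open>u\<close>, so \<open>z\<close> has at least the vertical
  displacement of \<open>u\<close>. By compactness of the torus, the maximal rotation number is the growth rate
  of the maximal displacement in \<open>n\<close> steps, hence monotone in \<open>\<lambda>\<close>.
\<close>

section \<open>Maximal growth rate of a cocycle\<close>

text \<open>Cut the orbit greedily into blocks of length at most \<open>N\<close> along which the
  average growth is at most \<open>c\<close>. Only a final piece shorter than \<open>N\<close> is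
  left uncontrolled, and \<open>C\<close> pays for it.\<close>

lemma cocycle_upper_bound:
  fixes S :: "nat \<Rightarrow> 'a \<Rightarrow> real"
  assumes cocycle: "\<And>m n p. S (m + n) p = S m p + S n ((T ^^ m) p)"
    and bound: "\<And>n p. \<bar>S n p\<bar> \<le> real n * B"
    and step: "\<And>p. \<exists>j\<in>{1..N}. S j p \<le> real j * c"
  shows "\<exists>C. \<forall>n p. S n p \<le> real n * c + C"
proof -
  define C where "C = real N * (\<bar>B\<bar> + \<bar>c\<bar>)"
  have "S n p \<le> real n * c + C" for n p
  proof (induction n arbitrary: p rule: less_induct)
    case (less n)
    show ?case
    proof (cases "n < N")
      case True
      have "S n p - real n * c \<le> real n * (\<bar>B\<bar> + \<bar>c\<bar>)"
      proof -
        have "real n * B \<le> real n * \<bar>B\<bar>" "real n * - c \<le> real n * \<bar>c\<bar>"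
          by (intro mult_left_mono; simp)+
        then show ?thesis
          using abs_le_D1[OF bound, of n p] by (simp add: distrib_left)
      qed
      also have "\<dots> \<le> C"
        unfolding C_def using True by (intro mult_right_mono) auto
      finally show ?thesis by simp
    next
      case False
      obtain j where j: "j \<in> {1..N}" "S j p \<le> real j * c"
        using step by blast
      have "S n p = S j p + S (n - j) ((T ^^ j) p)"
        using cocycle[of j "n - j" p] j False by simp
      also have "\<dots> \<le> real j * c + (real (n - j) * c + C)"
        using j False by (intro add_mono less) auto
      also have "\<dots> = real n * c + C"
        using j False by (simp add: of_nat_diff algebra_simps)
      finally show ?thesis .
    qed
  qed
  then show ?thesis by blast
qed

lemma affine_le_imp_slope_le:
  fixes a c C :: real
  assumes "\<And>n. real n * a \<le> real n * c + C"
  shows "a \<le> c"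
proof (rule ccontr)
  assume "\<not> a \<le> c"
  then obtain n where "C < real n * (a - c)"
    using reals_Archimedean3[of "a - c"] by auto
  then show False
    using assms[of n] by (simp add: algebra_simps)
qed

text \<open>\<open>M\<close> is the infimum of the slopes of uniform affine upper bounds. If no
  orbit stayed above slope \<open>M\<close> at all times, compactness would make time and deficit
  uniform, and cutting orbits into blocks would give a slope below \<open>M\<close>.
  \<open>K\<close> acts as a fundamental domain.\<close>

lemma cocycle_max_growth:
  fixes S :: "nat \<Rightarrow> 'a::topological_space \<Rightarrow> real"
  assumes cocycle: "\<And>m n p. S (m + n) p = S m p + S n ((T ^^ m) p)"
    and bound: "\<And>n p. \<bar>S n p\<bar> \<le> real n * B"
    and cont: "\<And>n. continuous_on UNIV (S n)"
    and K: "compact K" "\<And>p. \<exists>q\<in>K. \<forall>n. S n q = S n p"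
  obtains M p where "\<And>n. real n * M \<le> S n p"
    and "\<And>c. M < c \<Longrightarrow> \<exists>C. \<forall>n q. S n q \<le> real n * c + C"
proof -
  define R where "R = {c. \<exists>C. \<forall>n p. S n p \<le> real n * c + C}"
  define M where "M = Inf R"
  have "B \<in> R"
    unfolding R_def using abs_le_D1[OF bound] by (auto intro!: exI[of _ 0])
  have "- B \<le> c" if c: "c \<in> R" for c
  proof -
    obtain C where C: "\<And>n p. S n p \<le> real n * c + C"
      using c by (auto simp: R_def)
    show ?thesis
    proof (rule affine_le_imp_slope_le)
      fix n
      show "real n * - B \<le> real n * c + C"
        using C[of n undefined] bound[of n undefined] by (simp add: abs_le_iff)
    qed
  qed
  then have bdd: "bdd_below R" by (auto simp: bdd_below_def)
  have upper: "\<exists>C. \<forall>n q. S n q \<le> real n * c + C" if c: "M < c" for c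
  proof -
    obtain d where d: "d \<in> R" "d < c"
      using c bdd \<open>B \<in> R\<close> unfolding M_def by (metis cInf_lessD empty_iff)
    then obtain C where C: "\<And>n p. S n p \<le> real n * d + C"
      by (auto simp: R_def)
    have "S n q \<le> real n * c + C" for n q
      using C[of n q] mult_left_mono[of d c "real n"] d by simp
    then show ?thesis by blast
  qed
  have "\<exists>p. \<forall>n. real n * M \<le> S n p"
  proof (rule ccontr)
    assume no: "\<nexists>p. \<forall>n. real n * M \<le> S n p"
    \<comment> \<open>A single index bounds both the time and the deficit, so the sets increase with
      \<open>n\<close> and a finite subcover reduces to one set \<open>U N\<close>.\<close>
    define U where "U n = (\<Union>j\<in>{1..n}. {p. S j p < real j * (M - 1 / real n)})" for n
    have "open (U n)" for n
      unfolding U_def by (intro open_UN ballI open_Collect_less cont continuous_on_const)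
    have U_mono: "U m \<subseteq> U n" if "m \<le> n" for m n
    proof
      fix p assume "p \<in> U m"
      then obtain j where j: "1 \<le> j" "j \<le> m" "S j p < real j * (M - 1 / real m)"
        by (auto simp: U_def)
      have "1 / real n \<le> 1 / real m"
        using that j by (intro divide_left_mono) auto
      then have "real j * (M - 1 / real m) \<le> real j * (M - 1 / real n)"
        by (intro mult_left_mono) auto
      with that j have "j \<in> {1..n}" "S j p < real j * (M - 1 / real n)"
        by (simp, linarith)
      then show "p \<in> U n" unfolding U_def by blast
    qed
    have cover: "\<exists>n. p \<in> U n" for p
    proof -
      obtain j where j: "S j p < real j * M"
        using no by (meson not_le)
      \<comment> \<open>The bound forces \<open>S 0 p = 0\<close>, so time 0 cannot show a
        deficit.\<close>
      have "j \<noteq> 0" using j bound[of 0 p] by (intro notI) simp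
      define e where "e = M - S j p / real j"
      have "e > 0" using j \<open>j \<noteq> 0\<close> by (simp add: e_def field_simps)
      then obtain k where k: "k > 0" "1 / real k < e"
        using real_arch_inverse[of e] by (auto simp: inverse_eq_divide)
      have "1 / real (max j k) \<le> 1 / real k"
        using k by (intro divide_left_mono) auto
      then have "S j p / real j < M - 1 / real (max j k)"
        using k by (simp add: e_def)
      then have "S j p < real j * (M - 1 / real (max j k))"
        using \<open>j \<noteq> 0\<close> by (simp add: divide_less_eq mult.commute)
      moreover have "j \<in> {1..max j k}" using \<open>j \<noteq> 0\<close> by auto
      ultimately have "p \<in> U (max j k)" unfolding U_def by blast
      then show ?thesis ..
    qed
    obtain F where F: "finite F" "K \<subseteq> (\<Union>n\<in>F. U n)"
      using compactE_image[OF K(1), of UNIV U] \<open>\<And>n. open (U n)\<close> cover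
      by (metis UNIV_I UN_I subsetI)
    \<comment> \<open>\<open>insert 0\<close> covers the case of empty \<open>F\<close>;
      \<open>Suc\<close> makes \<open>N\<close> positive, so that \<open>1 / real N\<close> is a
      genuine gain at the end.\<close>
    define N where "N = Suc (Max (insert 0 F))"
    have "n \<le> N" if "n \<in> F" for n
      using that F(1) unfolding N_def by (meson Max_ge finite.insertI insertI2 le_SucI)
    then have KN: "K \<subseteq> U N"
      using F(2) U_mono by blast
    have "\<exists>j\<in>{1..N}. S j p \<le> real j * (M - 1 / real N)" for p
    proof -
      obtain q where "q \<in> K" "\<forall>n. S n q = S n p" using K(2) by blast
      then show ?thesis using KN unfolding U_def by (force intro: less_imp_le)
    qed
    then have "M - 1 / real N \<in> R"
      unfolding R_def using cocycle_upper_bound[OF cocycle bound] by blast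
    then have "M \<le> M - 1 / real N"
      unfolding M_def using bdd by (rule cInf_lower)
    then show False by (simp add: N_def)
  qed
  with upper that show thesis by blast
qed

section \<open>A discrete Dirichlet problem\<close>

text \<open>The solution is the pointwise supremum of all subsolutions below \<open>u\<close>: where the inequality
  is strict, the value could be raised without violating the inequalities at the neighbours.\<close>

lemma perron_dirichlet:
  fixes f :: "real \<Rightarrow> real" and u w :: "nat \<Rightarrow> real"
  assumes cont: "continuous_on UNIV f"
    and w: "\<And>i. w i \<le> u i" "w 0 = u 0" "w (Suc n) = u (Suc n)"
    and sub: "\<And>i. i < n \<Longrightarrow> 2 * w (Suc i) + f (w (Suc i)) \<le> w i + w (Suc (Suc i))"
    and super: "\<And>i. i < n \<Longrightarrow> u i + u (Suc (Suc i)) < 2 * u (Suc i) + f (u (Suc i))"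
  obtains z where "\<And>i. z i \<le> u i" "z 0 = u 0" "z (Suc n) = u (Suc n)"
    and "\<And>i. i < n \<Longrightarrow> z i + z (Suc (Suc i)) = 2 * z (Suc i) + f (z (Suc i))"
proof -
  define V where "V = {v. (\<forall>i. v i \<le> u i) \<and> v 0 = u 0 \<and> v (Suc n) = u (Suc n) \<and>
    (\<forall>i<n. 2 * v (Suc i) + f (v (Suc i)) \<le> v i + v (Suc (Suc i)))}"
  define z where "z i = (SUP v\<in>V. v i)" for i
  define h where "h t = 2 * t + f t" for t
  have h: "isCont h t" for t
    unfolding h_def using cont by (intro continuous_intros) (simp add: continuous_on_eq_continuous_at)
  have "w \<in> V" using w sub by (simp add: V_def)
  then have ne: "V \<noteq> {}" by blast
  have bdd: "bdd_above ((\<lambda>v. v i) ` V)" for i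
    by (rule bdd_aboveI[of _ "u i"]) (auto simp: V_def)
  have V_le_z: "v i \<le> z i" if "v \<in> V" for v i
    unfolding z_def using that bdd by (rule cSUP_upper)
  have z_le_u: "z i \<le> u i" for i
    unfolding z_def using ne by (rule cSUP_least) (simp add: V_def)
  have z0: "z 0 = u 0" and zn: "z (Suc n) = u (Suc n)"
    using V_le_z[OF \<open>w \<in> V\<close>, of 0] V_le_z[OF \<open>w \<in> V\<close>, of "Suc n"] z_le_u[of 0] z_le_u[of "Suc n"] w
    by simp_all
  \<comment> \<open>A failure at \<open>z\<close> would persist near \<open>z (Suc i)\<close> by
    continuity, hence hit some \<open>v\<close> in \<open>V\<close> with \<open>v (Suc i)\<close>
    close to the supremum; the neighbours of \<open>v\<close> lie below those of \<open>z\<close>,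
    so \<open>v\<close> would not be a subsolution.\<close>
  have z_sub: "h (z (Suc i)) \<le> z i + z (Suc (Suc i))" if i: "i < n" for i
  proof (rule ccontr)
    assume "\<not> ?thesis"
    then have "h (z (Suc i)) > z i + z (Suc (Suc i))" by simp
    then have "\<forall>\<^sub>F t in at (z (Suc i)). h t > z i + z (Suc (Suc i))"
      using h[of "z (Suc i)"] unfolding isCont_def by (intro order_tendstoD)
    then obtain d where d: "d > 0"
      "\<And>t. t \<noteq> z (Suc i) \<Longrightarrow> \<bar>t - z (Suc i)\<bar> < d \<Longrightarrow> h t > z i + z (Suc (Suc i))"
      by (auto simp: eventually_at dist_real_def)
    have "z (Suc i) - d < (SUP v\<in>V. v (Suc i))" using d by (simp add: z_def)
    then obtain v where v: "v \<in> V" "z (Suc i) - d < v (Suc i)"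
      using ne bdd by (auto simp: less_cSUP_iff)
    have "h (v (Suc i)) > z i + z (Suc (Suc i))"
      using d(2)[of "v (Suc i)"] v V_le_z[OF v(1), of "Suc i"] \<open>h (z (Suc i)) > _\<close>
      by (cases "v (Suc i) = z (Suc i)") auto
    moreover have "h (v (Suc i)) \<le> v i + v (Suc (Suc i))"
      using v i by (simp add: V_def h_def)
    ultimately show False
      using V_le_z[OF v(1), of i] V_le_z[OF v(1), of "Suc (Suc i)"] by simp
  qed
  have z_eq: "z i + z (Suc (Suc i)) = h (z (Suc i))" if i: "i < n" for i
  proof (rule ccontr)
    assume "\<not> ?thesis"
    with z_sub[OF i] have less: "h (z (Suc i)) < z i + z (Suc (Suc i))" by simp
    \<comment> \<open>Contact with \<open>u\<close> contradicts the strictness of the supersolution,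
      so there is room to raise \<open>z\<close> at this site.\<close>
    have "z (Suc i) \<noteq> u (Suc i)"
    proof
      assume "z (Suc i) = u (Suc i)"
      then show False
        using z_sub[OF i] super[OF i] z_le_u[of i] z_le_u[of "Suc (Suc i)"] by (simp add: h_def)
    qed
    with z_le_u[of "Suc i"] have lt: "z (Suc i) < u (Suc i)" by simp
    have "\<forall>\<^sub>F t in at (z (Suc i)). h t < z i + z (Suc (Suc i))"
      using h[of "z (Suc i)"] less unfolding isCont_def by (intro order_tendstoD)
    then obtain d where d: "d > 0"
      "\<And>t. t \<noteq> z (Suc i) \<Longrightarrow> \<bar>t - z (Suc i)\<bar> < d \<Longrightarrow> h t < z i + z (Suc (Suc i))"
      by (auto simp: eventually_at dist_real_def)
    \<comment> \<open>The first bound keeps \<open>t\<close> where the inequality is still strict,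
      the second keeps it below the barrier \<open>u\<close>. Raising this value only enlarges the
      right-hand sides at the neighbouring sites.\<close>
    define t where "t = z (Suc i) + min (d / 2) (u (Suc i) - z (Suc i))"
    have t: "z (Suc i) < t" "t \<le> u (Suc i)" "h t < z i + z (Suc (Suc i))"
      using d lt by (auto simp: t_def intro!: d(2))
    define v where "v = z(Suc i := t)"
    have "h (v (Suc k)) \<le> v k + v (Suc (Suc k))" if k: "k < n" for k
      using t z_sub[OF k] by (auto simp: v_def)
    moreover have "v k \<le> u k" for k
      using t z_le_u by (simp add: v_def)
    moreover have "v 0 = u 0" "v (Suc n) = u (Suc n)"
      using i z0 zn by (auto simp: v_def)
    ultimately have "v \<in> V"
      unfolding V_def h_def by blast
    then show False
      using V_le_z[of v "Suc i"] t by (simp add: v_def)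
  qed
  show thesis
    using that[OF z_le_u z0 zn] z_eq unfolding h_def by blast
qed

section \<open>The lifted twist map\<close>

definition twist_lift :: "(real \<Rightarrow> real) \<Rightarrow> real \<Rightarrow> real \<times> real \<Rightarrow> real \<times> real" where
  "twist_lift f l = (\<lambda>(x, y). (x + (f x + y + l), f x + y + l))"

definition displacement :: "(real \<Rightarrow> real) \<Rightarrow> real \<Rightarrow> nat \<Rightarrow> real \<times> real \<Rightarrow> real" where
  "displacement f l n p = snd ((twist_lift f l ^^ n) p) - snd p"

lemma twist_map_funpow:
  assumes "\<And>x. g (to_circle x) = f x"
  shows "(twist_map g l ^^ n) (to_circle x, y) =
    map_prod to_circle id ((twist_lift f l ^^ n) (x, y))"
proof (induction n)
  case (Suc n)
  have "to_circle a + to_circle b = to_circle (a + b)" for a b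
    by (simp add: plus_circle.abs_eq)
  then show ?case
    using Suc assms by (simp add: twist_map_def twist_lift_def Let_def split_beta map_prod_def)
qed simp

lemma displacement_add:
  "displacement f l (m + n) p = displacement f l m p + displacement f l n ((twist_lift f l ^^ m) p)"
  by (subst add.commute) (simp add: displacement_def funpow_add)

lemma displacement_bound:
  assumes "\<And>x. \<bar>f x\<bar> \<le> B"
  shows "\<bar>displacement f l n p\<bar> \<le> real n * (B + \<bar>l\<bar>)"
proof (induction n)
  case (Suc n)
  let ?q = "(twist_lift f l ^^ n) p"
  have "displacement f l (Suc n) p = displacement f l n p + (f (fst ?q) + l)"
    by (simp add: displacement_def twist_lift_def split_beta)
  then show ?case
    using Suc assms[of "fst ?q"] by (simp add: algebra_simps)
qed (simp add: displacement_def)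

lemma continuous_on_displacement:
  assumes "continuous_on UNIV f"
  shows "continuous_on UNIV (displacement f l n)"
proof -
  have "continuous_on UNIV (\<lambda>p. (twist_lift f l ^^ n) p)"
  proof (induction n)
    case (Suc n)
    have "continuous_on UNIV (\<lambda>p. f (fst ((twist_lift f l ^^ n) p)))"
      using Suc by (intro continuous_on_compose2[OF assms] continuous_intros) auto
    moreover have "(twist_lift f l ^^ Suc n) p = (let q = (twist_lift f l ^^ n) p in
        (fst q + (f (fst q) + snd q + l), f (fst q) + snd q + l))" for p
      by (simp add: twist_lift_def[of f l] split_beta Let_def)
    ultimately show ?case
      using Suc unfolding Let_def by (simp only:) (intro continuous_intros)
  qed (simp add: continuous_on_id)
  then show ?thesis
    unfolding displacement_def by (intro continuous_intros)
qed

lemma periodic_add_Ints: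
  fixes f :: "real \<Rightarrow> 'a"
  assumes "\<And>x. f (x + 1) = f x" "k \<in> \<int>"
  shows "f (x + k) = f x"
proof -
  have nat: "f (x + real m) = f x" for m x
  proof (induction m)
    case (Suc m)
    then show ?case using assms(1)[of "x + real m"] by (simp add: add_ac)
  qed simp
  obtain j where j: "k = of_int j" using assms(2) by (auto elim: Ints_cases)
  show ?thesis
  proof (cases "j \<ge> 0")
    case True
    then show ?thesis using nat[of x "nat j"] j by simp
  next
    case False
    then show ?thesis using nat[of "x + k" "nat (- j)"] j by simp
  qed
qed

text \<open>A vertical shift by \<open>b\<close> moves the \<open>n\<close>-th base point by the
  further integer \<open>real n * b\<close>, which \<open>f\<close> does not see.\<close>

lemma displacement_periodic:
  assumes f: "\<And>x. f (x + 1) = f x" and ab: "a \<in> \<int>" "b \<in> \<int>"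
  shows "displacement f l n (x + a, y + b) = displacement f l n (x, y)"
proof -
  have "(twist_lift f l ^^ n) (x + a, y + b) =
    (twist_lift f l ^^ n) (x, y) + (a + real n * b, b)"
  proof (induction n)
    case (Suc n)
    obtain s t where st: "(twist_lift f l ^^ n) (x, y) = (s, t)" by fastforce
    have "f (s + (a + real n * b)) = f s"
      using ab by (intro periodic_add_Ints[of f, OF f]) simp
    moreover have "(twist_lift f l ^^ n) (x + a, y + b) = (s + (a + real n * b), t + b)"
      using Suc st by simp
    ultimately show ?case
      using st by (simp add: twist_lift_def distrib_right)
  qed (simp add: zero_prod_def)
  then show ?thesis by (simp add: displacement_def)
qed

text \<open>Provides the compact fundamental domain required by
  \<open>cocycle_max_growth\<close>.\<close>

lemma displacement_unit_square:
  assumes f: "\<And>x. f (x + 1) = f x"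
  shows "\<exists>q\<in>{0..1} \<times> {0..1}. \<forall>n. displacement f l n q = displacement f l n p"
proof
  let ?q = "(frac (fst p), frac (snd p))"
  show "?q \<in> {0..1} \<times> {0..1}"
    by (simp add: frac_ge_0 frac_lt_1 less_imp_le)
  have "displacement f l n (fst p + - of_int \<lfloor>fst p\<rfloor>, snd p + - of_int \<lfloor>snd p\<rfloor>)
      = displacement f l n (fst p, snd p)" for n
    by (rule displacement_periodic[of f, OF f]) auto
  then show "\<forall>n. displacement f l n ?q = displacement f l n p"
    by (simp add: frac_def)
qed

lemma displacement_mono:
  assumes cont: "continuous_on UNIV f" and B: "\<And>x. \<bar>f x\<bar> \<le> B" and "l1 < l2"
  shows "\<exists>q. displacement f l1 n p \<le> displacement f l2 n q"
proof -
  define X where "X i = fst ((twist_lift f l1 ^^ i) p)" for i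
  define Y where "Y i = snd ((twist_lift f l1 ^^ i) p)" for i
  have XY: "X (Suc i) = X i + Y (Suc i)" "Y (Suc i) = f (X i) + Y i + l1" for i
    by (simp_all add: X_def Y_def twist_lift_def split_beta)
  \<comment> \<open>The extra initial value is the base point one step before the orbit starts, so
    that the first increment of \<open>u\<close> is \<open>Y 0\<close>.\<close>
  define u where "u i = (case i of 0 \<Rightarrow> X 0 - Y 0 | Suc j \<Rightarrow> X j)" for i
  have uY: "u (Suc i) - u i = Y i" for i
    by (cases i) (simp_all add: u_def XY)
  have u: "u i + u (Suc (Suc i)) = 2 * u (Suc i) + f (u (Suc i)) + l1" for i
    using uY[of i] uY[of "Suc i"] XY(2)[of i] by (simp add: u_def)
  \<comment> \<open>The second difference of \<open>i * (Suc n - i)\<close> is -2, so subtracting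
    \<open>K\<close> times it adds \<open>2 * K\<close>. This outweighs the change of
    \<open>f\<close>, at most \<open>2 * B\<close>, and the gap \<open>l2 - l1\<close>, making
    \<open>w\<close> a subsolution. Beyond \<open>Suc n\<close> the truncated subtraction gives
    \<open>w = u\<close>.\<close>
  define K where "K = B + (l2 - l1)"
  have "K \<ge> 0" using B[of 0] \<open>l1 < l2\<close> by (simp add: K_def)
  define w where "w i = u i - K * (real i * real (Suc n - i))" for i
  obtain z where z: "\<And>i. z i \<le> u i" "z 0 = u 0" "z (Suc n) = u (Suc n)"
    "\<And>i. i < n \<Longrightarrow> z i + z (Suc (Suc i)) = 2 * z (Suc i) + (f (z (Suc i)) + l2)"
  proof (rule perron_dirichlet[of "\<lambda>x. f x + l2" w u n])
    show "continuous_on UNIV (\<lambda>x. f x + l2)" using cont by (intro continuous_intros)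
    show "w i \<le> u i" for i using \<open>K \<ge> 0\<close> by (simp add: w_def)
    show "w 0 = u 0" "w (Suc n) = u (Suc n)" by (simp_all add: w_def)
    show "u i + u (Suc (Suc i)) < 2 * u (Suc i) + (f (u (Suc i)) + l2)" if "i < n" for i
      using u[of i] \<open>l1 < l2\<close> by simp
    show "2 * w (Suc i) + (f (w (Suc i)) + l2) \<le> w i + w (Suc (Suc i))" if i: "i < n" for i
    proof -
      have "w i + w (Suc (Suc i)) - 2 * w (Suc i) = f (u (Suc i)) + l1 + 2 * K"
        using u[of i] i by (simp add: w_def of_nat_diff algebra_simps)
      then show ?thesis
        using B[of "u (Suc i)"] B[of "w (Suc i)"] \<open>l1 < l2\<close> by (simp add: K_def)
    qed
  qed blast
  define q where "q = (z 1, z 1 - z 0)"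
  have orbit: "i \<le> n \<Longrightarrow> (twist_lift f l2 ^^ i) q = (z (Suc i), z (Suc i) - z i)" for i
  proof (induction i)
    case (Suc i)
    then show ?case using z(4)[of i] by (simp add: twist_lift_def)
  qed (simp add: q_def)
  have "displacement f l1 n p = (u (Suc n) - u n) - (u 1 - u 0)"
    using uY[of n] uY[of 0] by (simp add: displacement_def Y_def)
  also have "\<dots> \<le> (z (Suc n) - z n) - (z 1 - z 0)"
    using z(1)[of n] z(1)[of 1] z(2,3) by simp
  also have "\<dots> = displacement f l2 n q"
    using orbit[of n] by (simp add: displacement_def q_def)
  finally show ?thesis by blast
qed

section \<open>Monotonicity of the maximal rotation number\<close>

lemma real_analytic_imp_continuous_on:
  assumes "real_analytic f"
  shows "continuous_on UNIV f"
proof -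
  have "isCont f x" for x
  proof -
    obtain F where "(\<lambda>h. f (x + h)) has_fps_expansion F"
      using assms by (auto simp: real_analytic_def)
    then have "isCont (\<lambda>h. f (x + h)) 0"
      by (rule has_fps_expansion_imp_continuous)
    then show ?thesis
      by (simp add: isCont_def LIM_offset_zero_iff)
  qed
  then show ?thesis by (simp add: continuous_on_eq_continuous_at)
qed

lemma periodic_continuous_bounded:
  fixes f :: "real \<Rightarrow> real"
  assumes f: "\<And>x. f (x + 1) = f x" and "continuous_on UNIV f"
  obtains B where "\<And>x. \<bar>f x\<bar> \<le> B"
proof -
  have "compact (f ` {0..1})"
    using assms(2) by (intro compact_continuous_image) (auto intro: continuous_on_subset)
  then obtain B where B: "\<And>y. y \<in> f ` {0..1} \<Longrightarrow> \<bar>y\<bar> \<le> B"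
    by (metis bounded_real compact_imp_bounded)
  have "\<bar>f x\<bar> \<le> B" for x
  proof -
    have "f (x + - of_int \<lfloor>x\<rfloor>) = f x"
      by (rule periodic_add_Ints[of f, OF f]) auto
    then have "f x = f (frac x)" by (simp add: frac_def)
    moreover have "frac x \<in> {0..1}" by (simp add: frac_ge_0 frac_lt_1 less_imp_le)
    ultimately show ?thesis using B by simp
  qed
  then show thesis using that by blast
qed

lemma vertical_rotation_set_twist_map:
  assumes "\<And>x. g (to_circle x) = f x"
  shows "vertical_rotation_set (twist_map g l) =
    {\<omega>. \<exists>p. (\<lambda>n. displacement f l n p / real n) \<longlonglongrightarrow> \<omega>}"
proof -
  have disp: "snd ((twist_map g l ^^ n) (to_circle x, y)) - y = displacement f l n (x, y)" for n x y
    using twist_map_funpow[of g f, OF assms] by (simp add: displacement_def)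
  have ex: "(\<exists>X. P X) \<longleftrightarrow> (\<exists>x y. P (to_circle x, y))" for P :: "circle \<times> real \<Rightarrow> bool"
  proof
    assume "\<exists>X. P X"
    then obtain c y where "P (c, y)" by auto
    then show "\<exists>x y. P (to_circle x, y)"
      by (induction c rule: circle.abs_induct) blast
  qed blast
  show ?thesis
    unfolding vertical_rotation_set_def ex by (simp add: disp)
qed

text \<open>Replaces the maximum over limits by growth bounds. The orbit of \<open>p\<close> is
  squeezed to the slope \<open>M\<close>, which the upper bounds forbid any other limit to exceed;
  hence the maximum is attained.\<close>

lemma rho_V_max_twist_map:
  assumes gf: "\<And>x. g (to_circle x) = f x" and per: "\<And>x. f (x + 1) = f x"
    and cont: "continuous_on UNIV f"
  obtains p where "\<And>n. real n * rho_V_max (twist_map g l) \<le> displacement f l n p"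
    and "\<And>c. rho_V_max (twist_map g l) < c \<Longrightarrow> \<exists>C. \<forall>n q. displacement f l n q \<le> real n * c + C"
proof -
  obtain B where B: "\<And>x. \<bar>f x\<bar> \<le> B"
    using periodic_continuous_bounded[of f, OF per cont] by blast
  obtain M p where low: "\<And>n. real n * M \<le> displacement f l n p"
    and up: "\<And>c. M < c \<Longrightarrow> \<exists>C. \<forall>n q. displacement f l n q \<le> real n * c + C"
  proof (rule cocycle_max_growth[of "displacement f l" "twist_lift f l" "B + \<bar>l\<bar>" "{0..1} \<times> {0..1}"])
    show "compact ({0..1::real} \<times> {0..1::real})" by (intro compact_Times compact_Icc)
  qed (use displacement_add displacement_bound[of f, OF B] continuous_on_displacement[OF cont]
      displacement_unit_square[of f, OF per] in blast)+
  have ev: "\<forall>\<^sub>F n in sequentially. displacement f l n q / real n < c" if "M < c" for q c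
  proof -
    \<comment> \<open>The slack between \<open>d\<close> and \<open>c\<close> absorbs the vanishing
      term \<open>C / real n\<close>.\<close>
    define d where "d = (M + c) / 2"
    have d: "M < d" "d < c" using that by (auto simp: d_def)
    obtain C where C: "\<And>n. displacement f l n q \<le> real n * d + C"
      using up[OF d(1)] by blast
    have "(\<lambda>n. d + C / real n) \<longlonglongrightarrow> d + 0"
      by (intro tendsto_intros lim_const_over_n)
    then have "\<forall>\<^sub>F n in sequentially. d + C / real n < c"
      using d by (intro order_tendstoD) auto
    moreover have "\<forall>\<^sub>F n in sequentially. 0 < n" by (rule eventually_gt_at_top)
    ultimately show ?thesis
    proof eventually_elim
      case (elim n)
      have "displacement f l n q / real n \<le> (real n * d + C) / real n"
        using C[of n] by (rule divide_right_mono) simp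
      also have "\<dots> = d + C / real n" using elim by (simp add: add_divide_distrib)
      finally show ?case using elim by simp
    qed
  qed
  have "rho_V_max (twist_map g l) = M"
    unfolding rho_V_max_def vertical_rotation_set_twist_map[of g f, OF gf]
  proof (rule Greatest_equality)
    have "(\<lambda>n. displacement f l n p / real n) \<longlonglongrightarrow> M"
    proof (rule order_tendstoI)
      fix c assume "c < M"
      show "\<forall>\<^sub>F n in sequentially. c < displacement f l n p / real n"
        using eventually_gt_at_top[of 0]
      proof eventually_elim
        case (elim n)
        then have "M \<le> displacement f l n p / real n"
          using low[of n] by (simp add: le_divide_eq mult.commute)
        with \<open>c < M\<close> show ?case by simp
      qed
    qed (rule ev)
    then show "M \<in> {\<omega>. \<exists>p. (\<lambda>n. displacement f l n p / real n) \<longlonglongrightarrow> \<omega>}" by blast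
  next
    fix \<omega> assume "\<omega> \<in> {\<omega>. \<exists>p. (\<lambda>n. displacement f l n p / real n) \<longlonglongrightarrow> \<omega>}"
    then obtain q where q: "(\<lambda>n. displacement f l n q / real n) \<longlonglongrightarrow> \<omega>" by blast
    show "\<omega> \<le> M"
    proof (rule dense_ge)
      fix c assume "M < c"
      from ev[OF this, of q] show "\<omega> \<le> c"
        by (intro tendsto_upperbound[OF q]) (auto elim: eventually_mono)
    qed
  qed
  with low up that show thesis by blast
qed

theorem lemma1:
  fixes g :: "circle \<Rightarrow> real"
  assumes "circle_analytic g"
    and "g \<noteq> (\<lambda>x. 0)"
    and "circle_integral g = 0"
  shows "mono (\<lambda>l. rho_V_max (twist_map g l))"
proof -
  obtain f where f: "real_analytic f" and per: "\<And>x. f (x + 1) = f x"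
    and gf: "\<And>x. g (to_circle x) = f x"
    using assms(1) by (auto simp: circle_analytic_def)
  have cont: "continuous_on UNIV f"
    using f by (rule real_analytic_imp_continuous_on)
  obtain B where B: "\<And>x. \<bar>f x\<bar> \<le> B"
    using periodic_continuous_bounded[of f, OF per cont] by blast
  let ?M = "\<lambda>l. rho_V_max (twist_map g l)"
  have le: "?M l1 \<le> ?M l2" if "l1 < l2" for l1 l2
  \<comment> \<open>Uniform upper bounds are available only for slopes strictly above the maximum
    for \<open>l2\<close>.\<close>
  proof (rule dense_ge)
    fix c assume c: "?M l2 < c"
    obtain p where p: "\<And>n. real n * ?M l1 \<le> displacement f l1 n p"
      using rho_V_max_twist_map[of g f l1, OF gf per cont] by metis
    have "\<exists>C. \<forall>n q. displacement f l2 n q \<le> real n * c + C"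
      by (rule rho_V_max_twist_map[of g f l2, OF gf per cont]) (use c in blast)
    then obtain C where C: "\<And>n q. displacement f l2 n q \<le> real n * c + C" by blast
    show "?M l1 \<le> c"
    proof (rule affine_le_imp_slope_le)
      fix n
      \<comment> \<open>The point \<open>q\<close> varies with \<open>n\<close>; this is harmless
        because \<open>C\<close> is uniform over all starting points.\<close>
      obtain q where "displacement f l1 n p \<le> displacement f l2 n q"
        using displacement_mono[of f, OF cont B \<open>l1 < l2\<close>] by blast
      then show "real n * ?M l1 \<le> real n * c + C"
        using p[of n] C[of n q] by linarith
    qed
  qed
  show ?thesis
    by (rule monoI) (metis le order_le_less)
qed

end
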